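(* Let $\Delta_c$ be a concrete first-order unification context, let $T$ be a concrete term, let $\Delta_1$ be a (flattened) unification context, and let $k\ge 0$. Suppose that $\mathrm{exp}^{\Delta_c}_k(\underline s)=\mathrm{exp}^{\Delta_1}_k(\underline s)$ for every recursion constant $\underline s$ occurring in $T$. Then: (1) if $T \rhd^{\mathrm{con}} U \diamond \Delta_2$, then $\mathrm{exp}^{\Delta_c}_k(T)=\mathrm{exp}^{\Delta_1,\Delta_2}_k(U)$; (2) if $T \rhd^{\mathrm{rec}} N \diamond \Delta_2$, then $\mathrm{exp}^{\Delta_c}_k(T)=\mathrm{exp}^{\Delta_1,\Delta_2}_k(N)$.
   Context: Fix constructors $c,d,e$ (each with an arity), unification metavariables $H,G,\dots$, and recursion constants $\underline r,\underline s,\underline t$. Concrete syntax: concrete terms $T ::= c\,T_1\cdots T_n \mid H \mid \underline r$; a concrete unification context $\Delta_c$ is a finite list of equations $T_1\doteq T_2$ and recursive definitions $\underline r =_d c\,T_1\cdots T_n$ (the body always has a constructor head). Flattened syntax: each unification metavariable is tagged contractive ($H^{\mathrm{con}}$) or recursive ($H^{\mathrm{rec}}$). Contractive terms $U ::= c\,N_1\cdots N_n \mid H^{\mathrm{con}}$; recursive terms $N ::= \underline r \mid H^{\mathrm{rec}}$. A unification context $\Delta$ is a finite collection of equations $U_1\doteq U_2$, equations $N_1\doteq N_2$, recursive definitions $\underline r =_d U$, and possibly a symbol $\mathrm{contra}$. For contexts $\Delta_1,\Delta_2$, the union $\Delta_1,\Delta_2$ is formed after consistently renaming recursion constants of $\Delta_2$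 so the defined constants are disjoint. Depth-$k$ expansion into $M_\bot ::= c\,(M_\bot)_1\cdots(M_\bot)_n \mid H^{\mathrm{con}}\mid H^{\mathrm{rec}}\mid \bot$: for concrete terms, $\mathrm{exp}^{\Delta_c}_0(T)=\bot$; $\mathrm{exp}^{\Delta_c}_{k+1}(c\,T_1\cdots T_n)=c\,(\mathrm{exp}^{\Delta_c}_k(T_1))\cdots(\mathrm{exp}^{\Delta_c}_k(T_n))$; $\mathrm{exp}^{\Delta_c}_{k+1}(H)=H^{\mathrm{rec}}$; $\mathrm{exp}^{\Delta_c}_{k+1}(\underline r)=\mathrm{exp}^{\Delta_c}_{k+1}(c\,T_1\cdots T_n)$ where $\underline r=_d c\,T_1\cdots T_n\in\Delta_c$. For flattened terms, $\mathrm{exp}^\Delta_0(M)=\bot$; $\mathrm{exp}^\Delta_{k+1}(H^{m})=H^{m}$; $\mathrm{exp}^\Delta_{k+1}(c\,N_1\cdots N_n)=c\,(\mathrm{exp}^\Delta_k(N_1))\cdots(\mathrm{exp}^\Delta_k(N_n))$; $\mathrm{exp}^\Delta_{k+1}(\underline r)=\mathrm{exp}^\Delta_{k+1}(U)$ where $\underline r=_d U\in\Delta$. Translation judgments are defined inductively by: (i) $H \rhd^{\mathrm{rec}} H^{\mathrm{rec}}\diamond[\,]$; (ii) $\underline r\rhd^{\mathrm{rec}}\underline r\diamond[\,]$; (iii) if $c\,T_1\cdots T_n\rhd^{\mathrm{con}}U\diamond\Delta$ then $c\,T_1\cdots T_n\rhd^{\mathrm{rec}}\underline r\diamond(\Delta,\underline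 r=_d U)$ for a fresh recursion constant $\underline r$; (iv) if $T_i\rhd^{\mathrm{rec}}N_i\diamond\Delta_i$ for $1\le i\le n$ then $c\,T_1\cdots T_n\rhd^{\mathrm{con}} c\,N_1\cdots N_n\diamond(\Delta_1,\dots,\Delta_n)$ (there are no $\rhd^{\mathrm{con}}$ rules for $H$ or $\underline r$). Fresh recursion constants are chosen not to occur in $\Delta_c$ or $\Delta_1$. *)

theory Defs
  imports Main
begin

text \<open>
  Type parameters throughout: \<open>'c\<close> constructors, \<open>'h\<close> unification metavariables,
  \<open>'r\<close> recursion constants.  Constructors are applied to lists; the arity discipline is
  imposed by the predicates \<open>wf_...\<close>.
\<close>

section \<open>Concrete syntax\<close>

datatype (ccons: 'c, cmetas: 'h, crecs: 'r) cterm =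
    CApp 'c "('c, 'h, 'r) cterm list"
  | CMeta 'h
  | CRec 'r

text \<open>\<open>CDef r c Ts\<close> is the definition of \<open>r\<close> as \<open>c Ts\<close>, so that bodies have a constructor head.\<close>

datatype (centry_cons: 'c, centry_metas: 'h, centry_recs: 'r) centry =
    CEq "('c, 'h, 'r) cterm" "('c, 'h, 'r) cterm"
  | CDef 'r 'c "('c, 'h, 'r) cterm list"

type_synonym ('c, 'h, 'r) cctx = "('c, 'h, 'r) centry list"

definition cdefs :: "('c, 'h, 'r) cctx \<Rightarrow> ('r \<times> 'c \<times> ('c, 'h, 'r) cterm list) list" where
  "cdefs \<Delta> = [(r, c, Ts). CDef r c Ts \<leftarrow> \<Delta>]"

definition cctx_recs :: "('c, 'h, 'r) cctx \<Rightarrow> 'r set" where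
  "cctx_recs \<Delta> = (\<Union>e \<in> set \<Delta>. centry_recs e)"

fun wf_cterm :: "('c \<Rightarrow> nat) \<Rightarrow> ('c, 'h, 'r) cterm \<Rightarrow> bool" where
  "wf_cterm ar (CApp c Ts) \<longleftrightarrow> length Ts = ar c \<and> (\<forall>T \<in> set Ts. wf_cterm ar T)"
| "wf_cterm ar (CMeta H) \<longleftrightarrow> True"
| "wf_cterm ar (CRec r) \<longleftrightarrow> True"

fun wf_centry :: "('c \<Rightarrow> nat) \<Rightarrow> ('c, 'h, 'r) centry \<Rightarrow> bool" where
  "wf_centry ar (CEq T1 T2) \<longleftrightarrow> wf_cterm ar T1 \<and> wf_cterm ar T2"
| "wf_centry ar (CDef r c Ts) \<longleftrightarrow> wf_cterm ar (CApp c Ts)"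

definition wf_cctx :: "('c \<Rightarrow> nat) \<Rightarrow> ('c, 'h, 'r) cctx \<Rightarrow> bool" where
  "wf_cctx ar \<Delta> \<longleftrightarrow> (\<forall>e \<in> set \<Delta>. wf_centry ar e) \<and> distinct (map fst (cdefs \<Delta>))"

section \<open>Flattened syntax\<close>

datatype (rmetas: 'h, rrecs: 'r) rterm =
    RRec 'r
  | RMeta 'h

datatype (ucons: 'c, umetas: 'h, urecs: 'r) uterm =
    UApp 'c "('h, 'r) rterm list"
  | UMeta 'h

datatype (entry_cons: 'c, entry_metas: 'h, entry_recs: 'r) entry =
    EqCon "('c, 'h, 'r) uterm" "('c, 'h, 'r) uterm"
  | EqRec "('h, 'r) rterm" "('h, 'r) rterm"
  | Def 'r "('c, 'h, 'r) uterm"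
  | Contra

type_synonym ('c, 'h, 'r) ctx = "('c, 'h, 'r) entry list"

definition defs :: "('c, 'h, 'r) ctx \<Rightarrow> ('r \<times> ('c, 'h, 'r) uterm) list" where
  "defs \<Delta> = [(r, U). Def r U \<leftarrow> \<Delta>]"

definition defined :: "('c, 'h, 'r) ctx \<Rightarrow> 'r set" where
  "defined \<Delta> = fst ` set (defs \<Delta>)"

definition ctx_recs :: "('c, 'h, 'r) ctx \<Rightarrow> 'r set" where
  "ctx_recs \<Delta> = (\<Union>e \<in> set \<Delta>. entry_recs e)"

fun wf_uterm :: "('c \<Rightarrow> nat) \<Rightarrow> ('c, 'h, 'r) uterm \<Rightarrow> bool" where
  "wf_uterm ar (UApp c Ns) \<longleftrightarrow> length Ns = ar c"
| "wf_uterm ar (UMeta H) \<longleftrightarrow> True"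

fun wf_entry :: "('c \<Rightarrow> nat) \<Rightarrow> ('c, 'h, 'r) entry \<Rightarrow> bool" where
  "wf_entry ar (EqCon U1 U2) \<longleftrightarrow> wf_uterm ar U1 \<and> wf_uterm ar U2"
| "wf_entry ar (EqRec N1 N2) \<longleftrightarrow> True"
| "wf_entry ar (Def r U) \<longleftrightarrow> wf_uterm ar U"
| "wf_entry ar Contra \<longleftrightarrow> True"

definition wf_ctx :: "('c \<Rightarrow> nat) \<Rightarrow> ('c, 'h, 'r) ctx \<Rightarrow> bool" where
  "wf_ctx ar \<Delta> \<longleftrightarrow> (\<forall>e \<in> set \<Delta>. wf_entry ar e) \<and> distinct (map fst (defs \<Delta>))"

section \<open>Depth-bounded expansion\<close>

datatype ('c, 'h) bterm =
    BApp 'c "('c, 'h) bterm list"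
  | BMetaCon 'h
  | BMetaRec 'h
  | Bot

text \<open>
  Expansion is only meaningful for recursion constants that have a definition; the value \<open>Bot\<close>
  at an undefined constant is a totality convention.  As well-formed contexts define a constant
  at most once, \<open>map_of\<close> returns the body of the definition of \<open>r\<close>.
\<close>

function cexp :: "('c, 'h, 'r) cctx \<Rightarrow> nat \<Rightarrow> ('c, 'h, 'r) cterm \<Rightarrow> ('c, 'h) bterm" where
  "cexp \<Delta> 0 T = Bot"
| "cexp \<Delta> (Suc k) (CApp c Ts) = BApp c (map (cexp \<Delta> k) Ts)"
| "cexp \<Delta> (Suc k) (CMeta H) = BMetaRec H"
| "cexp \<Delta> (Suc k) (CRec r) =
     (case map_of (cdefs \<Delta>) r of
        Some (c, Ts) \<Rightarrow> cexp \<Delta> (Suc k) (CApp c Ts)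
      | None \<Rightarrow> Bot)"
  by pat_completeness auto
termination
  by (relation "measures [\<lambda>(\<Delta>, k, T). k, \<lambda>(\<Delta>, k, T). case T of CRec r \<Rightarrow> 1 | _ \<Rightarrow> 0]") auto

function exp_con :: "('c, 'h, 'r) ctx \<Rightarrow> nat \<Rightarrow> ('c, 'h, 'r) uterm \<Rightarrow> ('c, 'h) bterm"
  and exp_rec :: "('c, 'h, 'r) ctx \<Rightarrow> nat \<Rightarrow> ('h, 'r) rterm \<Rightarrow> ('c, 'h) bterm" where
  "exp_con \<Delta> 0 U = Bot"
| "exp_con \<Delta> (Suc k) (UMeta H) = BMetaCon H"
| "exp_con \<Delta> (Suc k) (UApp c Ns) = BApp c (map (exp_rec \<Delta> k) Ns)"
| "exp_rec \<Delta> 0 N = Bot"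
| "exp_rec \<Delta> (Suc k) (RMeta H) = BMetaRec H"
| "exp_rec \<Delta> (Suc k) (RRec r) =
     (case map_of (defs \<Delta>) r of
        Some U \<Rightarrow> exp_con \<Delta> (Suc k) U
      | None \<Rightarrow> Bot)"
  by pat_completeness auto
termination
  by (relation "measures [case_sum (\<lambda>(\<Delta>, k, U). k) (\<lambda>(\<Delta>, k, N). k),
                          case_sum (\<lambda>_. 0) (\<lambda>_. 1)]") auto

section \<open>Translation\<close>

text \<open>
  Recursion constants are only relevant up to consistent renaming.  Here the names are chosen
  up front, so that contexts can be joined by list concatenation without further renaming: the
  constants introduced by the translation occur neither in the translated term nor in the parts
  being joined with.  Freshness with respect to ambient contexts is a condition on \<open>defined \<Delta>\<close>,
  which consists precisely of the constants introduced in the derivation.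
\<close>

inductive trans_con ::
    "('c, 'h, 'r) cterm \<Rightarrow> ('c, 'h, 'r) uterm \<Rightarrow> ('c, 'h, 'r) ctx \<Rightarrow> bool"
    (\<open>(_ \<rhd>con _ \<diamondop> _)\<close> [51, 51, 51] 50)
  and trans_rec ::
    "('c, 'h, 'r) cterm \<Rightarrow> ('h, 'r) rterm \<Rightarrow> ('c, 'h, 'r) ctx \<Rightarrow> bool"
    (\<open>(_ \<rhd>rec _ \<diamondop> _)\<close> [51, 51, 51] 50)
where
  rec_meta: "CMeta H \<rhd>rec RMeta H \<diamondop> []"
| rec_const: "CRec r \<rhd>rec RRec r \<diamondop> []"
| rec_app: "CApp c Ts \<rhd>con U \<diamondop> \<Delta> \<Longrightarrow> r \<notin> crecs (CApp c Ts) \<union> ctx_recs \<Delta> \<Longrightarrow>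
    CApp c Ts \<rhd>rec RRec r \<diamondop> \<Delta> @ [Def r U]"
| con_app: "length Ns = length Ts \<Longrightarrow> length \<Delta>s = length Ts \<Longrightarrow>
    (\<And>i. i < length Ts \<Longrightarrow> Ts ! i \<rhd>rec Ns ! i \<diamondop> \<Delta>s ! i) \<Longrightarrow>
    (\<And>i. i < length Ts \<Longrightarrow> defined (\<Delta>s ! i) \<inter> crecs (CApp c Ts) = {}) \<Longrightarrow>
    (\<And>i j. i < length Ts \<Longrightarrow> j < length Ts \<Longrightarrow> i \<noteq> j \<Longrightarrow>
      defined (\<Delta>s ! i) \<inter> defined (\<Delta>s ! j) = {}) \<Longrightarrow>
    CApp c Ts \<rhd>con UApp c Ns \<diamondop> concat \<Delta>s"

end

(*
  In the joined context every constant introduced by the translation unfolds to the body recorded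
  for it, so expansion agrees by induction on the translation derivation. Descending below a
  constructor lowers the depth, and the hypothesis on the recursion constants of T survives because
  the expansion at a smaller depth is a truncation of the one at a larger depth. The constants of T
  have the same expansion in Delta1 and in the joined context since freshness keeps everything
  reachable from them outside Delta2.
*)

theory Submission imports Defs begin

text \<open>Cutting an expansion at a smaller depth lets an equality at depth \<open>k\<close> be
  lowered without looking at the terms that produced it. The last equation is reached at positive
  depth by undefined constants, whose expansion is \<open>Bot\<close>.\<close>

fun truncate :: "nat \<Rightarrow> ('c, 'h) bterm \<Rightarrow> ('c, 'h) bterm" where
  "truncate 0 M = Bot"
| "truncate (Suc k) (BApp c Ms) = BApp c (map (truncate k) Ms)"
| "truncate (Suc k) (BMetaCon H) = BMetaCon H"
| "truncate (Suc k) (BMetaRec H) = BMetaRec H"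
| "truncate (Suc k) Bot = Bot"

lemma truncate_cexp: "j \<le> k \<Longrightarrow> truncate j (cexp \<Delta> k T) = cexp \<Delta> j T"
proof (induction \<Delta> k T arbitrary: j rule: cexp.induct)
  case (2 \<Delta> k c Ts)
  then show ?case by (cases j) auto
next
  case (3 \<Delta> k H)
  then show ?case by (cases j) auto
next
  case (4 \<Delta> k r)
  show ?case
  proof (cases "map_of (cdefs \<Delta>) r")
    case None
    then show ?thesis by (cases j) auto
  next
    case (Some p)
    obtain c Ts where p: "p = (c, Ts)" by fastforce
    \<comment> \<open>Unfolding a definition keeps the depth, so the induction hypothesis applies
      with the same \<open>j\<close>.\<close>
    have "truncate j (cexp \<Delta> (Suc k) (CApp c Ts)) = cexp \<Delta> j (CApp c Ts)"
      using 4 Some p by blast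
    then show ?thesis using Some p by (cases j) auto
  qed
qed auto

lemma truncate_exp:
  shows "j \<le> k \<Longrightarrow> truncate j (exp_con \<Delta> k U) = exp_con \<Delta> j U"
    and "j \<le> k \<Longrightarrow> truncate j (exp_rec \<Delta> k N) = exp_rec \<Delta> j N"
proof (induction \<Delta> k U and \<Delta> k N arbitrary: j and j rule: exp_con_exp_rec.induct)
  case (2 \<Delta> k H)
  then show ?case by (cases j) auto
next
  case (3 \<Delta> k c Ns)
  then show ?case by (cases j) auto
next
  case (5 \<Delta> k H)
  then show ?case by (cases j) auto
next
  case (6 \<Delta> k r)
  then show ?case by (cases j) (auto split: option.splits)
qed auto

text \<open>Apply \<open>truncate j\<close> to both sides. This carries the assumption on the
  constants of the term below a constructor.\<close>

lemma cexp_eq_exp_rec_le: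
  assumes "cexp \<Delta>c k T = exp_rec \<Delta> k N" and "j \<le> k"
  shows "cexp \<Delta>c j T = exp_rec \<Delta> j N"
  using assms by (metis truncate_cexp truncate_exp(2))

lemma set_defs: "set (defs \<Delta>) = {(r, U). Def r U \<in> set \<Delta>}"
  unfolding defs_def by (induction \<Delta>) (auto split: entry.splits)

lemma defs_append: "defs (\<Delta> @ \<Delta>') = defs \<Delta> @ defs \<Delta>'"
  by (simp add: defs_def)

lemma set_defs_concat: "set (defs (concat \<Delta>s)) = (\<Union>i < length \<Delta>s. set (defs (\<Delta>s ! i)))"
proof -
  have "set (defs (concat \<Delta>s)) = (\<Union>\<Delta> \<in> set \<Delta>s. set (defs \<Delta>))"
    by (auto simp: set_defs)
  also have "set \<Delta>s = (!) \<Delta>s ` {..<length \<Delta>s}"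
    by (auto simp: set_conv_nth)
  finally show ?thesis by simp
qed

lemma defined_concat: "defined (concat \<Delta>s) = (\<Union>i < length \<Delta>s. defined (\<Delta>s ! i))"
  by (simp add: defined_def set_defs_concat image_UN)

lemma mem_defined_iff: "r \<in> defined \<Delta> \<longleftrightarrow> (\<exists>U. Def r U \<in> set \<Delta>)"
  unfolding defined_def set_defs by force

lemma defined_subset_ctx_recs: "defined \<Delta> \<subseteq> ctx_recs \<Delta>"
  by (force simp: mem_defined_iff ctx_recs_def)

lemma defined_snoc: "defined (\<Delta> @ [Def r U]) = insert r (defined \<Delta>)"
  by (auto simp: mem_defined_iff)

lemma map_of_defs_eq_None_iff: "map_of (defs \<Delta>) r = None \<longleftrightarrow> r \<notin> defined \<Delta>"
  by (simp add: defined_def map_of_eq_None_iff)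

lemma map_of_defs_append:
  "r \<notin> defined \<Delta>' \<Longrightarrow> map_of (defs (\<Delta> @ \<Delta>')) r = map_of (defs \<Delta>) r"
  by (cases "map_of (defs \<Delta>) r")
    (simp_all add: defs_append map_add_def flip: map_of_defs_eq_None_iff)

text \<open>Expansion in \<open>\<Delta>\<close> only meets constants of the starting term and of
  bodies recorded in \<open>\<Delta>\<close>. None of these is defined in \<open>\<Delta>'\<close>,
  so every lookup gives the same result in both contexts, including a failed one.\<close>

lemma exp_append_fresh:
  shows "defined \<Delta>' \<inter> (urecs U \<union> ctx_recs \<Delta>) = {} \<Longrightarrow>
      exp_con (\<Delta> @ \<Delta>') k U = exp_con \<Delta> k U"
    and "defined \<Delta>' \<inter> (rrecs N \<union> ctx_recs \<Delta>) = {} \<Longrightarrow>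
      exp_rec (\<Delta> @ \<Delta>') k N = exp_rec \<Delta> k N"
proof (induction \<Delta> k U and \<Delta> k N rule: exp_con_exp_rec.induct)
  case (3 \<Delta> k c Ns)
  then show ?case by (fastforce simp: disjoint_iff)
next
  case (6 \<Delta> k r)
  then have map_eq: "map_of (defs (\<Delta> @ \<Delta>')) r = map_of (defs \<Delta>) r"
    by (intro map_of_defs_append) auto
  show ?case
  proof (cases "map_of (defs \<Delta>) r")
    case None
    then show ?thesis using map_eq by simp
  next
    case (Some U)
    then have "Def r U \<in> set \<Delta>" using map_of_SomeD set_defs by fastforce
    \<comment> \<open>The constants of a body already lie in \<open>ctx_recs \<Delta>\<close>, so
      the disjointness assumption is preserved by unfolding.\<close>
    then have "urecs U \<subseteq> ctx_recs \<Delta>" by (force simp: ctx_recs_def)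
    then have "exp_con (\<Delta> @ \<Delta>') (Suc k) U = exp_con \<Delta> (Suc k) U"
      using 6 Some by blast
    then show ?thesis using map_eq Some by simp
  qed
qed auto

lemma trans_defined_fresh:
  shows "T \<rhd>con U \<diamondop> \<Delta> \<Longrightarrow> defined \<Delta> \<inter> crecs T = {}"
    and "T \<rhd>rec N \<diamondop> \<Delta> \<Longrightarrow> defined \<Delta> \<inter> crecs T = {}"
proof (induction rule: trans_con_trans_rec.inducts)
  case (con_app Ns Ts \<Delta>s c)
  \<comment> \<open>The side condition of the rule speaks of the whole term and thus covers sibling
    arguments, which the induction hypothesis for argument \<open>i\<close> does not.\<close>
  have "defined (\<Delta>s ! i) \<inter> crecs (CApp c Ts) = {}" if "i < length \<Delta>s" for i
    using con_app.hyps(2,4) that by simp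
  then show ?case unfolding defined_concat by blast
next
  case (rec_app c Ts U \<Delta> r)
  then show ?case unfolding defined_snoc by blast
qed (simp_all add: defined_def defs_def)

text \<open>A new constant is fresh for the context it extends, and contexts of distinct arguments
  define disjoint sets. This ensures that \<open>map_of\<close> finds the body recorded by the
  translation.\<close>

lemma trans_single_valued_defs:
  shows "T \<rhd>con U \<diamondop> \<Delta> \<Longrightarrow> single_valued (set (defs \<Delta>))"
    and "T \<rhd>rec N \<diamondop> \<Delta> \<Longrightarrow> single_valued (set (defs \<Delta>))"
proof (induction rule: trans_con_trans_rec.inducts)
  case (rec_app c Ts U \<Delta> r)
  then have "r \<notin> defined \<Delta>" using defined_subset_ctx_recs[of \<Delta>] by auto
  then show ?case using rec_app
    by (auto simp: single_valued_def set_defs mem_defined_iff)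
next
  case (con_app Ns Ts \<Delta>s c)
  show ?case
  proof (rule single_valuedI)
    fix r U U'
    assume "(r, U) \<in> set (defs (concat \<Delta>s))" and "(r, U') \<in> set (defs (concat \<Delta>s))"
    then obtain i j where ij: "i < length Ts" "j < length Ts"
      and U: "(r, U) \<in> set (defs (\<Delta>s ! i))" and U': "(r, U') \<in> set (defs (\<Delta>s ! j))"
      using con_app.hyps(2) unfolding set_defs_concat by auto
    have "r \<in> defined (\<Delta>s ! i) \<inter> defined (\<Delta>s ! j)"
      using U U' by (auto simp: mem_defined_iff set_defs)
    then have "i = j" using con_app.hyps(5)[OF ij] by blast
    then show "U = U'" using con_app.IH[OF ij(1)] U U' by (meson single_valuedD)
  qed
qed (auto simp: defs_def)

text \<open>Asking only that lookup in \<open>\<Delta>\<close> returns each body of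
  \<open>\<Delta>2\<close> makes the claim inductive: the condition passes to the context of each
  argument while \<open>\<Delta>\<close> stays fixed and \<open>k\<close> varies.\<close>

lemma trans_exp_eq:
  shows "T \<rhd>con U \<diamondop> \<Delta>2 \<Longrightarrow> set (defs \<Delta>2) \<subseteq> Map.graph (map_of (defs \<Delta>)) \<Longrightarrow>
      \<forall>s \<in> crecs T. cexp \<Delta>c k (CRec s) = exp_rec \<Delta> k (RRec s) \<Longrightarrow>
      cexp \<Delta>c k T = exp_con \<Delta> k U"
    and "T \<rhd>rec N \<diamondop> \<Delta>2 \<Longrightarrow> set (defs \<Delta>2) \<subseteq> Map.graph (map_of (defs \<Delta>)) \<Longrightarrow>
      \<forall>s \<in> crecs T. cexp \<Delta>c k (CRec s) = exp_rec \<Delta> k (RRec s) \<Longrightarrow>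
      cexp \<Delta>c k T = exp_rec \<Delta> k N"
proof (induction arbitrary: k and k rule: trans_con_trans_rec.inducts)
  case (rec_meta H)
  then show ?case by (cases k) auto
next
  case (rec_const r)
  then show ?case by simp
next
  case (rec_app c Ts U \<Delta>2 r)
  have "(r, U) \<in> Map.graph (map_of (defs \<Delta>))" and sub: "set (defs \<Delta>2) \<subseteq> Map.graph (map_of (defs \<Delta>))"
    using rec_app.prems(1) by (simp_all add: defs_def)
  then have "map_of (defs \<Delta>) r = Some U" by (simp add: Map.graph_def)
  \<comment> \<open>At depth 0 both sides are \<open>Bot\<close>; otherwise \<open>r\<close> unfolds
    to \<open>U\<close> without lowering the depth.\<close>
  then have "exp_rec \<Delta> k (RRec r) = exp_con \<Delta> k U" by (cases k) simp_all
  with rec_app.IH[OF sub rec_app.prems(2)] show ?case by simp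
next
  case (con_app Ns Ts \<Delta>s c)
  show ?case
  proof (cases k)
    case 0
    then show ?thesis by simp
  next
    case (Suc j)
    have "cexp \<Delta>c j (Ts ! i) = exp_rec \<Delta> j (Ns ! i)" if i: "i < length Ts" for i
    proof -
      have "set (defs (\<Delta>s ! i)) \<subseteq> set (defs (concat \<Delta>s))"
        using con_app.hyps(2) i unfolding set_defs_concat by (intro UN_upper) simp
      then have "set (defs (\<Delta>s ! i)) \<subseteq> Map.graph (map_of (defs \<Delta>))"
        using con_app.prems(1) by (rule subset_trans)
      moreover have "\<forall>s \<in> crecs (Ts ! i). cexp \<Delta>c j (CRec s) = exp_rec \<Delta> j (RRec s)"
      proof
        fix s assume "s \<in> crecs (Ts ! i)"
        then have "s \<in> crecs (CApp c Ts)" using nth_mem[OF i] by auto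
        then have "cexp \<Delta>c k (CRec s) = exp_rec \<Delta> k (RRec s)" using con_app.prems(2) by blast
        then show "cexp \<Delta>c j (CRec s) = exp_rec \<Delta> j (RRec s)"
          by (rule cexp_eq_exp_rec_le) (simp add: Suc)
      qed
      ultimately show ?thesis by (rule con_app.IH[OF i])
    qed
    then have "map (cexp \<Delta>c j) Ts = map (exp_rec \<Delta> j) Ns"
      using con_app.hyps(1) by (intro nth_equalityI) simp_all
    then show ?thesis using Suc by simp
  qed
qed

text \<open>Lookup in the joined context searches \<open>\<Delta>\<close> first, where freshness
  makes it fail, and then \<open>\<Delta>'\<close>, where single-valuedness leaves only one possible
  body.\<close>

lemma defs_subset_graph_append:
  assumes "single_valued (set (defs \<Delta>'))" and "defined \<Delta>' \<inter> ctx_recs \<Delta> = {}"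
  shows "set (defs \<Delta>') \<subseteq> Map.graph (map_of (defs (\<Delta> @ \<Delta>')))"
proof (rule subrelI)
  fix r U
  assume rU: "(r, U) \<in> set (defs \<Delta>')"
  obtain V where V: "map_of (defs \<Delta>') r = Some V"
    using rU by (meson weak_map_of_SomeI)
  have "V = U"
    using single_valuedD[OF assms(1) map_of_SomeD[OF V] rU] .
  moreover have "r \<in> defined \<Delta>'"
    using rU by (force simp: defined_def)
  then have "map_of (defs \<Delta>) r = None"
    using assms(2) defined_subset_ctx_recs[of \<Delta>] unfolding map_of_defs_eq_None_iff by blast
  ultimately have "map_of (defs (\<Delta> @ \<Delta>')) r = Some U"
    using V by (simp add: defs_append map_add_def)
  then show "(r, U) \<in> Map.graph (map_of (defs (\<Delta> @ \<Delta>')))" by (simp add: Map.graph_def)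
qed

text \<open>Moves the assumption on the constants of \<open>T\<close> from \<open>\<Delta>\<close>
  to the joined context, by \<open>exp_append_fresh\<close> applied to each constant.\<close>

lemma crecs_exp_append:
  assumes "\<forall>s \<in> crecs T. cexp \<Delta>c k (CRec s) = exp_rec \<Delta> k (RRec s)"
    and "defined \<Delta>' \<inter> crecs T = {}" and "defined \<Delta>' \<inter> ctx_recs \<Delta> = {}"
  shows "\<forall>s \<in> crecs T. cexp \<Delta>c k (CRec s) = exp_rec (\<Delta> @ \<Delta>') k (RRec s)"
proof
  fix s assume s: "s \<in> crecs T"
  have "exp_rec (\<Delta> @ \<Delta>') k (RRec s) = exp_rec \<Delta> k (RRec s)"
    using s assms(2,3) by (intro exp_append_fresh(2)) auto
  then show "cexp \<Delta>c k (CRec s) = exp_rec (\<Delta> @ \<Delta>') k (RRec s)"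
    using assms(1) s by (simp only:)
qed

theorem theorem2p1:
  fixes ar :: "'c \<Rightarrow> nat"
    and \<Delta>c :: "('c, 'h, 'r) cctx"
    and T :: "('c, 'h, 'r) cterm"
    and \<Delta>1 :: "('c, 'h, 'r) ctx"
    and k :: nat
  assumes "wf_cctx ar \<Delta>c" and "wf_cterm ar T" and "wf_ctx ar \<Delta>1"
    and "\<forall>s \<in> crecs T. cexp \<Delta>c k (CRec s) = exp_rec \<Delta>1 k (RRec s)"
  shows "(\<forall>U \<Delta>2. (T \<rhd>con U \<diamondop> \<Delta>2) \<longrightarrow> defined \<Delta>2 \<inter> (cctx_recs \<Delta>c \<union> ctx_recs \<Delta>1) = {} \<longrightarrow>
            cexp \<Delta>c k T = exp_con (\<Delta>1 @ \<Delta>2) k U)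
       \<and> (\<forall>N \<Delta>2. (T \<rhd>rec N \<diamondop> \<Delta>2) \<longrightarrow> defined \<Delta>2 \<inter> (cctx_recs \<Delta>c \<union> ctx_recs \<Delta>1) = {} \<longrightarrow>
            cexp \<Delta>c k T = exp_rec (\<Delta>1 @ \<Delta>2) k N)"
proof (intro conjI allI impI)
  fix U \<Delta>2
  assume trans: "T \<rhd>con U \<diamondop> \<Delta>2"
    and fresh: "defined \<Delta>2 \<inter> (cctx_recs \<Delta>c \<union> ctx_recs \<Delta>1) = {}"
  show "cexp \<Delta>c k T = exp_con (\<Delta>1 @ \<Delta>2) k U"
  \<comment> \<open>The induction result is used with the joined context as \<open>\<Delta>\<close>;
    freshness of \<open>\<Delta>2\<close> supplies both of its conditions.\<close>
  proof (rule trans_exp_eq(1)[OF trans])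
    show "set (defs \<Delta>2) \<subseteq> Map.graph (map_of (defs (\<Delta>1 @ \<Delta>2)))"
      using trans_single_valued_defs(1)[OF trans] fresh by (intro defs_subset_graph_append) auto
    show "\<forall>s \<in> crecs T. cexp \<Delta>c k (CRec s) = exp_rec (\<Delta>1 @ \<Delta>2) k (RRec s)"
      using trans_defined_fresh(1)[OF trans] fresh assms(4) by (intro crecs_exp_append) blast+
  qed
next
  fix N \<Delta>2
  assume trans: "T \<rhd>rec N \<diamondop> \<Delta>2"
    and fresh: "defined \<Delta>2 \<inter> (cctx_recs \<Delta>c \<union> ctx_recs \<Delta>1) = {}"
  show "cexp \<Delta>c k T = exp_rec (\<Delta>1 @ \<Delta>2) k N"
  proof (rule trans_exp_eq(2)[OF trans])
    show "set (defs \<Delta>2) \<subseteq> Map.graph (map_of (defs (\<Delta>1 @ \<Delta>2)))"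
      using trans_single_valued_defs(2)[OF trans] fresh by (intro defs_subset_graph_append) auto
    show "\<forall>s \<in> crecs T. cexp \<Delta>c k (CRec s) = exp_rec (\<Delta>1 @ \<Delta>2) k (RRec s)"
      using trans_defined_fresh(2)[OF trans] fresh assms(4) by (intro crecs_exp_append) blast+
  qed
qed

end
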